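(* Let $\boldsymbol U,\boldsymbol U_P,\boldsymbol X,\boldsymbol X_P,\boldsymbol X_+,\boldsymbol W$ be the data matrices of the LPV system described in the context, let $K_{d0}\in\mathbb R^{m\times n}$ and $\bar K_d=[K_{d1},\dots,K_{d\ell}]\in\mathbb R^{m\times \ell n}$ be controller gains, and let $\mathcal V\in\mathbb R^{\mathcal T\times n(1+\ell+\ell^2)}$ be a matrix satisfying $$\mathcal N_{cl}:=\begin{bmatrix} I_n&0&0 \\ 0&I_\ell\otimes I_n&0 \\ K_{d0}&\bar K_d&0 \\ 0&I_\ell\otimes K_{d0}&I_\ell\otimes\bar K_d\end{bmatrix}=\boldsymbol G\mathcal V .$$ Suppose that there exist a matrix $P\in\mathbb S^n_{++}$ and scalars $\varepsilon_1>0$, $\sigma>1$, $\beta_1\in(0,1)$ such that, for all $p\in\mathcal P$, $$\begin{bmatrix} P&0&F(p)^\top\boldsymbol X_+^\top&P&F(p)^\top \\ 0&\sigma P&P&0&0 \\ \boldsymbol X_+F(p)&P&P-\varepsilon_1\Delta\Delta^\top&0&0 \\ P&0&0&\beta_1^{-1}P&0 \\ F(p)&0&0&0&\varepsilon_1I_{\mathcal T}\end{bmatrix}\succ0,$$ where $F(p)=\mathcal V\,\mathrm{Col}(I_n,\;p\otimes I_n,\;p\otimes p\otimes I_n)\,P$ and $\Delta=\sqrt{\mathcal T}\,\delta I_n$. Then the closed-loop LPV system $$x_{k+1}=\big(A_d(p_k)+B_d(p_k)K_d(p_k)\big)x_k+\omega_k,\qquad K_d(p)=K_{d0}+\sum_{i=1}^{\ell}p^{[i]}K_{di},$$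 is exponentially input-to-state stable (ISS).
   Context: Notation. $\mathbb S^n$ ($\mathbb S^n_{++}$) is the set of real symmetric (symmetric positive definite) $n\times n$ matrices; $\otimes$ is the Kronecker product; $\mathrm{Col}(X_1,\dots,X_s)$ stacks its arguments vertically; $p^{[i]}$ is the $i$-th entry of $p\in\mathbb R^\ell$. System. $n,m,\ell,\mathcal T$ are positive integers and $\mathcal P\subset\mathbb R^\ell$ is the set of admissible scheduling values. The LPV system is $x_{k+1}=A_d(p_k)x_k+B_d(p_k)u_k+\omega_k$, $k\in\mathbb N$, with $x_k,\omega_k\in\mathbb R^n$, $u_k\in\mathbb R^m$, $p_k\in\mathcal P$, and affine dependence $A_d(p)=A_{d0}+\sum_{i=1}^\ell p^{[i]}A_{di}$, $B_d(p)=B_{d0}+\sum_{i=1}^\ell p^{[i]}B_{di}$. Put $\mathcal A_d=[A_{d0},A_{d1},\dots,A_{d\ell}]$, $\mathcal B_d=[B_{d0},B_{d1},\dots,B_{d\ell}]$; then $x_{k+1}=\mathcal A_d\mathrm{Col}(x_k,p_k\otimes x_k)+\mathcal B_d\mathrm{Col}(u_k,p_k\otimes u_k)+\omega_k$. Perturbation assumption. There is a known $\delta>0$ such that $\|\omega_k\|\le\delta$ for all $k$ (both in the data and in closed-loop operation); in particular $\boldsymbol W\boldsymbol W^\top\preceq\Delta\Delta^\top$ with $\Delta=\sqrt{\mathcal T}\delta I_n$. Data. From a trajectory $\{u_k,p_k,x_k,\omega_k\}_{k=0}^{\mathcal T}$ of the system form $\boldsymbol U=[u_0,\dots,u_{\mathcal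 T-1}]$, $\boldsymbol U_P=[p_0\otimes u_0,\dots,p_{\mathcal T-1}\otimes u_{\mathcal T-1}]$, $\boldsymbol X=[x_0,\dots,x_{\mathcal T-1}]$, $\boldsymbol X_P=[p_0\otimes x_0,\dots,p_{\mathcal T-1}\otimes x_{\mathcal T-1}]$, $\boldsymbol X_+=[x_1,\dots,x_{\mathcal T}]$, $\boldsymbol W=[\omega_0,\dots,\omega_{\mathcal T-1}]$, so that $\boldsymbol X_+=\mathcal A_d\mathrm{Col}(\boldsymbol X,\boldsymbol X_P)+\mathcal B_d\mathrm{Col}(\boldsymbol U,\boldsymbol U_P)+\boldsymbol W$. Put $\boldsymbol G=\mathrm{Col}(\boldsymbol X,\boldsymbol X_P,\boldsymbol U,\boldsymbol U_P)$. Exponential ISS. A closed-loop system with state $x_k$ and perturbation $\omega_k$ is exponentially ISS if there exist $\alpha_1,\alpha_2>0$ and a class-$\mathcal K$ function $\gamma$ such that $\|x_k\|\le\alpha_1e^{-\alpha_2k}\|x_0\|+\gamma\big(\sup_{0\le s\le k-1}\|\omega_s\|\big)$ for all $k\in\mathbb N$, all $x_0$, all scheduling sequences in $\mathcal P$ and all admissible perturbation sequences (a supremum over the empty set is $0$). *)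

theory Defs
  imports "HOL-Analysis.Analysis"
begin

text \<open>
  Block matrices are indexed by sum types, so that \<open>A ||| B\<close> is the block row $[A, B]$ and
  \<open>A /// B\<close> is the block column $\mathrm{Col}(A, B)$.
\<close>

definition hcat :: "real^'a^'r \<Rightarrow> real^'b^'r \<Rightarrow> real^('a + 'b)^'r" (infixr \<open>|||\<close> 62)
  where "A ||| B = (\<chi> r c. case c of Inl a \<Rightarrow> A $ r $ a | Inr b \<Rightarrow> B $ r $ b)"

definition vcat :: "real^'c^'a \<Rightarrow> real^'c^'b \<Rightarrow> real^'c^('a + 'b)" (infixr \<open>'/'/'/\<close> 61)
  where "A /// B = (\<chi> r c. case r of Inl a \<Rightarrow> A $ a $ c | Inr b \<Rightarrow> B $ b $ c)"

text \<open>The block row $[K_1, \dots, K_\ell]$ of equally sized blocks; entry \<open>(i, j)\<close> of the column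
  index is column \<open>j\<close> of block \<open>i\<close>.\<close>

definition block_row :: "('l::finite \<Rightarrow> real^'n^'m) \<Rightarrow> real^('l \<times> 'n)^'m"
  where "block_row K = (\<chi> r c. K (fst c) $ r $ snd c)"

text \<open>
  Kronecker products are indexed by product types, the first component being the block index. A
  vector as left factor is a single column, so it leaves the column index (if any) of the right
  factor unchanged.
\<close>

definition kron :: "real^'b^'a \<Rightarrow> real^'d^'c \<Rightarrow> real^('b \<times> 'd)^('a \<times> 'c)" (infixr \<open>\<otimes>\<close> 71)
  where "A \<otimes> B = (\<chi> r c. A $ fst r $ fst c * B $ snd r $ snd c)"

definition kron_vm :: "real^'a \<Rightarrow> real^'d^'c \<Rightarrow> real^'d^('a \<times> 'c)" (infixr \<open>\<otimes>\<^sub>m\<close> 71)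
  where "p \<otimes>\<^sub>m B = (\<chi> r c. p $ fst r * B $ snd r $ c)"

definition kron_vv :: "real^'a \<Rightarrow> real^'c \<Rightarrow> real^('a \<times> 'c)" (infixr \<open>\<otimes>\<^sub>v\<close> 71)
  where "p \<otimes>\<^sub>v x = (\<chi> r. p $ fst r * x $ snd r)"

definition pos_def :: "real^'n^'n \<Rightarrow> bool"
  where "pos_def M \<longleftrightarrow> transpose M = M \<and> (\<forall>v. v \<noteq> 0 \<longrightarrow> v \<bullet> (M *v v) > 0)"

definition affine_dep :: "real^'c^'r \<Rightarrow> ('l::finite \<Rightarrow> real^'c^'r) \<Rightarrow> real^'l \<Rightarrow> real^'c^'r"
  where "affine_dep M0 M p = M0 + (\<Sum>i\<in>UNIV. p $ i *\<^sub>R M i)"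

text \<open>
  The matrix $[s_0, \dots, s_{\mathcal T-1}]$. The column index type \<open>'t\<close> has \<open>CARD('t)\<close> =
  $\mathcal T$ elements but no order, so \<open>idx\<close>, meant to be a bijection onto \<open>{..<CARD('t)}\<close>,
  gives the position of each column.
\<close>

definition data_mat :: "('t \<Rightarrow> nat) \<Rightarrow> (nat \<Rightarrow> real^'r) \<Rightarrow> real^'t^'r"
  where "data_mat idx s = (\<chi> i j. s (idx j) $ i)"

definition N_cl :: "real^'n^'m \<Rightarrow> ('l::finite \<Rightarrow> real^'n^'m) \<Rightarrow>
    real^('n + 'l \<times> 'n + 'l \<times> 'l \<times> 'n)^('n + 'l \<times> 'n + 'm + 'l \<times> 'm)"
  where "N_cl K0 K =
      (mat 1 ||| 0                         ||| 0)
  /// (0     ||| (mat 1 :: real^'l^'l) \<otimes> (mat 1 :: real^'n^'n) ||| 0)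
  /// (K0    ||| block_row K               ||| 0)
  /// (0     ||| (mat 1 :: real^'l^'l) \<otimes> K0 ||| (mat 1 :: real^'l^'l) \<otimes> block_row K)"

definition F_mat :: "real^('n + 'l \<times> 'n + 'l \<times> 'l \<times> 'n)^'t \<Rightarrow> real^'n^'n \<Rightarrow> real^'l \<Rightarrow> real^'n^'t"
  where "F_mat V P p = V ** (mat 1 /// p \<otimes>\<^sub>m mat 1 /// p \<otimes>\<^sub>m p \<otimes>\<^sub>m mat 1) ** P"

definition LMI_mat :: "real^'n^'n \<Rightarrow> real^'n^'t \<Rightarrow> real^'t^'n \<Rightarrow> real^'n^'n \<Rightarrow> real \<Rightarrow> real \<Rightarrow> real \<Rightarrow>
    real^('n + 'n + 'n + 'n + 't)^('n + 'n + 'n + 'n + 't)"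
  where "LMI_mat P F Xp \<Delta> \<epsilon>\<^sub>1 \<sigma> \<beta>\<^sub>1 =
      (P       ||| 0          ||| transpose F ** transpose Xp           ||| P                 ||| transpose F)
  /// (0       ||| \<sigma> *\<^sub>R P     ||| P                                     ||| 0                 ||| 0)
  /// (Xp ** F ||| P          ||| P - \<epsilon>\<^sub>1 *\<^sub>R (\<Delta> ** transpose \<Delta>)         ||| 0                 ||| 0)
  /// (P       ||| 0          ||| 0                                     ||| inverse \<beta>\<^sub>1 *\<^sub>R P   ||| 0)
  /// (F       ||| 0          ||| 0                                     ||| 0                 ||| \<epsilon>\<^sub>1 *\<^sub>R mat 1)"

definition class_K :: "(real \<Rightarrow> real) \<Rightarrow> bool"
  where "class_K \<gamma> \<longleftrightarrow> continuous_on {0..} \<gamma> \<and> strict_mono_on {0..} \<gamma> \<and> \<gamma> 0 = 0"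

text \<open>$\sup_{0\le s\le k-1}\|\omega_s\|$, with the explicit convention for the empty range.\<close>

definition sup_norm :: "(nat \<Rightarrow> 'a::real_normed_vector) \<Rightarrow> nat \<Rightarrow> real"
  where "sup_norm \<omega> k = (if k = 0 then 0 else (SUP s\<in>{..<k}. norm (\<omega> s)))"

text \<open>
  Exponential ISS of $x_{k+1} = f(p_k, x_k, \omega_k)$ for scheduling values in \<open>\<P>\<close> and admissible
  perturbation values in \<open>\<Omega>\<close>. The constants are uniform over all sequences.
\<close>

definition exp_ISS ::
    "'p set \<Rightarrow> 'a::real_normed_vector set \<Rightarrow> ('p \<Rightarrow> 'a \<Rightarrow> 'a \<Rightarrow> 'a) \<Rightarrow> bool"
  where "exp_ISS \<P> \<Omega> f \<longleftrightarrow>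
    (\<exists>\<alpha>\<^sub>1 > 0. \<exists>\<alpha>\<^sub>2 > 0. \<exists>\<gamma>. class_K \<gamma> \<and>
      (\<forall>p x \<omega>. (\<forall>k. p k \<in> \<P>) \<longrightarrow> (\<forall>k. \<omega> k \<in> \<Omega>) \<longrightarrow> (\<forall>k. x (Suc k) = f (p k) (x k) (\<omega> k)) \<longrightarrow>
        (\<forall>k. norm (x k) \<le> \<alpha>\<^sub>1 * exp (- \<alpha>\<^sub>2 * real k) * norm (x 0) + \<gamma> (sup_norm \<omega> k))))"

end

theory Submission
  imports Defs
begin

text \<open>
  Put $Q = P^{-1}$ and let $z = \mathcal V\,\mathrm{Col}(I, q \otimes I, q \otimes q \otimes I)\,\xi$.
  The gain condition says that $z$ combines the data columns into the closed loop at $(q, \xi)$, so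
  $\boldsymbol X_+ z = A_{cl}(q)\xi + \boldsymbol W z$. Evaluating the quadratic form of the LMI at
  $(Q\xi,\, Qw,\, -Qy,\, -\beta_1 Q\xi,\, \boldsymbol W^\top Q y)$ with $y = A_{cl}(q)\xi + w$, the unknown
  terms in $\boldsymbol W$ cancel and $\boldsymbol W \boldsymbol W^\top \preceq \Delta\Delta^\top$ absorbs the rest,
  leaving the dissipation inequality $y^\top Q y \le (1 - \beta_1)\,\xi^\top Q \xi + \sigma\, w^\top Q w$.
\<close>

subsection \<open>Block vectors\<close>

text \<open>Vector counterpart of \<open>///\<close>: with the rewrite rules below, block matrices
  act on block vectors block by block rather than entry by entry.\<close>

definition vjoin :: "real^'a \<Rightarrow> real^'b \<Rightarrow> real^('a + 'b)"
  where "vjoin a b = (\<chi> i. case i of Inl j \<Rightarrow> a $ j | Inr j \<Rightarrow> b $ j)"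

lemma sum_UNIV_Plus:
  fixes f :: "'a::finite + 'b::finite \<Rightarrow> 'c::comm_monoid_add"
  shows "sum f UNIV = (\<Sum>i\<in>UNIV. f (Inl i)) + (\<Sum>i\<in>UNIV. f (Inr i))"
  by (simp add: UNIV_Plus_UNIV[symmetric] sum.Plus del: UNIV_Plus_UNIV)

lemma sum_UNIV_Times:
  fixes f :: "'a::finite \<times> 'b::finite \<Rightarrow> 'c::comm_monoid_add"
  shows "sum f UNIV = (\<Sum>i\<in>UNIV. \<Sum>j\<in>UNIV. f (i, j))"
  by (simp add: UNIV_Times_UNIV[symmetric] sum.cartesian_product del: UNIV_Times_UNIV)

lemma hcat_vjoin: "(A ||| B) *v vjoin a b = A *v a + B *v b"
  by (simp add: vec_eq_iff matrix_vector_mult_def hcat_def vjoin_def sum_UNIV_Plus)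

lemma vcat_mult: "(A /// B) *v z = vjoin (A *v z) (B *v z)"
  by (auto simp: vec_eq_iff matrix_vector_mult_def vcat_def vjoin_def split: sum.split)

lemma inner_vjoin: "vjoin a b \<bullet> vjoin c d = a \<bullet> c + b \<bullet> d"
  by (simp add: inner_vec_def vjoin_def sum_UNIV_Plus)

lemma vjoin_eq_iff: "vjoin a b = vjoin c d \<longleftrightarrow> a = c \<and> b = d"
  by (auto simp: vec_eq_iff vjoin_def split: sum.splits)

lemma kron_vm_mult: "(p \<otimes>\<^sub>m B) *v z = p \<otimes>\<^sub>v (B *v z)"
  by (simp add: vec_eq_iff matrix_vector_mult_def kron_vm_def kron_vv_def sum_distrib_left mult.assoc)

text \<open>Mixed-product rule with an identity as left factor: in the sum over blocks, the entries
  of \<open>mat 1\<close> keep only the block with index \<open>r\<close>.\<close>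

lemma mat_1_kron_mult: "(mat 1 \<otimes> B) *v (p \<otimes>\<^sub>v z) = p \<otimes>\<^sub>v (B *v z)"
proof -
  have "(\<Sum>i\<in>UNIV. \<Sum>j\<in>UNIV. (if r = i then 1 else 0) * B $ s $ j * (p $ i * z $ j)) =
      p $ r * (\<Sum>j\<in>UNIV. B $ s $ j * z $ j)" for r s
  proof -
    have "(\<Sum>i\<in>UNIV. \<Sum>j\<in>UNIV. (if r = i then 1 else 0) * B $ s $ j * (p $ i * z $ j)) =
        (\<Sum>i\<in>UNIV. if r = i then p $ r * (\<Sum>j\<in>UNIV. B $ s $ j * z $ j) else 0)"
      by (rule sum.cong) (auto simp: sum_distrib_left mult_ac)
    then show ?thesis by simp
  qed
  then show ?thesis
    by (simp add: vec_eq_iff matrix_vector_mult_def kron_def kron_vv_def sum_UNIV_Times mat_def)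
qed

lemma block_row_mult: "block_row K *v (p \<otimes>\<^sub>v z) = (\<Sum>i\<in>UNIV. p $ i *\<^sub>R (K i *v z))"
  by (simp add: vec_eq_iff matrix_vector_mult_def block_row_def kron_vv_def sum_UNIV_Times
      sum_distrib_left mult_ac)

text \<open>Turns parameter dependence into constant matrices acting on the regressors
  \<open>z\<close> and \<open>p \<otimes>\<^sub>v z\<close>, so that the unknown coefficients act
  linearly on data columns.\<close>

lemma affine_dep_mult: "affine_dep M0 M p *v z = M0 *v z + block_row M *v (p \<otimes>\<^sub>v z)"
proof -
  have "(\<Sum>i\<in>UNIV. p $ i *\<^sub>R M i) *v z = (\<Sum>i\<in>UNIV. p $ i *\<^sub>R (M i *v z))"
    by (subst linear_sum[where f = "\<lambda>A. A *v z"])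
      (auto intro!: linearI simp: matrix_vector_mult_add_rdistrib scaleR_matrix_vector_assoc)
  then show ?thesis
    by (simp add: affine_dep_def matrix_vector_mult_add_rdistrib block_row_mult)
qed

subsection \<open>The closed loop in terms of the data\<close>

lemma data_mat_mult: "data_mat idx s *v z = (\<Sum>j\<in>UNIV. z $ j *\<^sub>R s (idx j))"
  by (simp add: vec_eq_iff matrix_vector_mult_def data_mat_def mult.commute)

text \<open>Moves a constant matrix inside a combination of data columns, so that an equation valid
  for each sample can be applied under the sum.\<close>

lemma matrix_data_mat_mult:
  "B *v (data_mat idx s *v z) = (\<Sum>j\<in>UNIV. z $ j *\<^sub>R (B *v s (idx j)))"
  by (simp add: data_mat_mult linear_sum[OF matrix_vector_mul_linear] matrix_vector_mult_scaleR)

text \<open>The result is the regressor of the closed loop at state \<open>\<xi>\<close> and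
  scheduling value \<open>q\<close>, with the input given by the feedback law. Its last block first
  appears as two Kronecker products with \<open>q\<close>, merged by additivity.\<close>

lemma N_cl_mult:
  "N_cl K0 K *v vjoin \<xi> (vjoin (q \<otimes>\<^sub>v \<xi>) (q \<otimes>\<^sub>v q \<otimes>\<^sub>v \<xi>)) =
    vjoin \<xi> (vjoin (q \<otimes>\<^sub>v \<xi>)
      (vjoin (affine_dep K0 K q *v \<xi>) (q \<otimes>\<^sub>v (affine_dep K0 K q *v \<xi>))))"
proof -
  have add: "q \<otimes>\<^sub>v (a + b) = q \<otimes>\<^sub>v a + q \<otimes>\<^sub>v b" for a b :: "real^'m"
    by (simp add: kron_vv_def vec_eq_iff algebra_simps)
  show ?thesis
    by (simp add: N_cl_def vcat_mult hcat_vjoin mat_1_kron_mult affine_dep_mult add)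
qed

text \<open>All samples obey one linear relation between regressors, perturbation and successor
  state, hence so does every weighted sum of them. The weights \<open>z q \<xi>\<close> make the
  summed regressors those of the closed loop, at arbitrary \<open>q\<close> and \<open>\<xi>\<close>
  and not just at recorded values.\<close>

lemma data_closed_loop:
  fixes x \<omega> :: "nat \<Rightarrow> real^'n" and u :: "nat \<Rightarrow> real^'m" and p :: "nat \<Rightarrow> real^'l"
    and idx :: "'t::finite \<Rightarrow> nat"
  assumes trajectory: "\<And>j. x (Suc (idx j)) =
      affine_dep A0 A (p (idx j)) *v x (idx j) + affine_dep B0 B (p (idx j)) *v u (idx j) + \<omega> (idx j)"
    and gains: "N_cl K0 K = (data_mat idx x /// data_mat idx (\<lambda>k. p k \<otimes>\<^sub>v x k) ///
      data_mat idx u /// data_mat idx (\<lambda>k. p k \<otimes>\<^sub>v u k)) ** V"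
  defines "z \<equiv> \<lambda>q \<xi>. V *v ((mat 1 /// q \<otimes>\<^sub>m mat 1 /// q \<otimes>\<^sub>m q \<otimes>\<^sub>m mat 1) *v \<xi>)"
  shows "data_mat idx (\<lambda>k. x (Suc k)) *v z q \<xi> =
    (affine_dep A0 A q + affine_dep B0 B q ** affine_dep K0 K q) *v \<xi> + data_mat idx \<omega> *v z q \<xi>"
proof -
  let ?X = "data_mat idx x" and ?XP = "data_mat idx (\<lambda>k. p k \<otimes>\<^sub>v x k)"
  let ?U = "data_mat idx u" and ?UP = "data_mat idx (\<lambda>k. p k \<otimes>\<^sub>v u k)"
  let ?z = "z q \<xi>"
  have "(?X /// ?XP /// ?U /// ?UP) *v ?z =
      N_cl K0 K *v vjoin \<xi> (vjoin (q \<otimes>\<^sub>v \<xi>) (q \<otimes>\<^sub>v q \<otimes>\<^sub>v \<xi>))"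
    unfolding gains z_def by (simp add: matrix_vector_mul_assoc[symmetric] vcat_mult kron_vm_mult)
  \<comment> \<open>Comparing the four blocks of both sides.\<close>
  then have z: "?X *v ?z = \<xi>" "?XP *v ?z = q \<otimes>\<^sub>v \<xi>" "?U *v ?z = affine_dep K0 K q *v \<xi>"
      "?UP *v ?z = q \<otimes>\<^sub>v (affine_dep K0 K q *v \<xi>)"
    by (simp_all add: N_cl_mult vcat_mult vjoin_eq_iff)
  have "data_mat idx (\<lambda>k. x (Suc k)) *v ?z =
      A0 *v (?X *v ?z) + block_row A *v (?XP *v ?z) + B0 *v (?U *v ?z) + block_row B *v (?UP *v ?z)
      + data_mat idx \<omega> *v ?z"
    unfolding matrix_data_mat_mult
    by (simp add: data_mat_mult trajectory affine_dep_mult scaleR_add_right sum.distrib algebra_simps)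
  then show ?thesis
    by (simp add: z matrix_vector_mult_add_rdistrib matrix_vector_mul_assoc[symmetric]
        affine_dep_mult[of A0 A] affine_dep_mult[of B0 B] add.assoc)
qed

text \<open>Quadratic-form version of the bound on W W^T: each entry of the vector is the inner
  product of one sample with \<open>c\<close>, so Cauchy-Schwarz bounds each of the
  \<open>CARD('t)\<close> squares.\<close>

lemma norm_transpose_data_mat_mult_le:
  fixes idx :: "'t::finite \<Rightarrow> nat"
  assumes "\<And>j. norm (s (idx j)) \<le> \<delta>"
  shows "(norm (transpose (data_mat idx s) *v c))\<^sup>2 \<le> real CARD('t) * \<delta>\<^sup>2 * (norm c)\<^sup>2"
proof -
  have "(s (idx j) \<bullet> c)\<^sup>2 \<le> \<delta>\<^sup>2 * (norm c)\<^sup>2" for j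
  proof -
    have "\<bar>s (idx j) \<bullet> c\<bar> \<le> \<delta> * norm c"
      using Cauchy_Schwarz_ineq2[of "s (idx j)" c] mult_right_mono[OF assms, of "norm c" j] by simp
    then have "\<bar>s (idx j) \<bullet> c\<bar>\<^sup>2 \<le> (\<delta> * norm c)\<^sup>2"
      by (intro power_mono) auto
    then show ?thesis by (simp add: power_mult_distrib)
  qed
  then have "(\<Sum>j\<in>UNIV. (s (idx j) \<bullet> c)\<^sup>2) \<le> real CARD('t) * (\<delta>\<^sup>2 * (norm c)\<^sup>2)"
    by (intro sum_bounded_above)
  moreover have "(transpose (data_mat idx s) *v c) $ j = s (idx j) \<bullet> c" for j
    by (simp add: transpose_def data_mat_def matrix_vector_mult_def inner_vec_def)
  ultimately show ?thesis
    unfolding power2_norm_eq_inner inner_vec_def[where 'b = 't]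
    by (simp add: power2_eq_square)
qed

subsection \<open>The dissipation inequality\<close>

lemma inner_transpose_mult: "a \<bullet> (transpose M *v b) = (M *v a) \<bullet> (b :: real^'n)"
  by (metis dot_lmul_matrix inner_commute transpose_matrix_vector transpose_transpose)

text \<open>Definiteness makes the kernel trivial. Symmetry of the inverse \<open>Q\<close> holds
  because \<open>transpose Q\<close> is a left inverse of \<open>P\<close>; positivity follows by
  evaluating the form of \<open>P\<close> at \<open>Q *v v\<close>.\<close>

lemma pos_def_inverse:
  fixes P :: "real^'n^'n"
  assumes "pos_def P"
  obtains Q where "pos_def Q" "P ** Q = mat 1"
proof -
  have "v = 0" if "P *v v = 0" for v
    using assms that unfolding pos_def_def by (metis inner_zero_right less_irrefl)
  then have "invertible P"
    unfolding invertible_left_inverse matrix_left_invertible_ker by blast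
  then obtain Q where Q: "P ** Q = mat 1" "Q ** P = mat 1"
    unfolding invertible_def by blast
  have sym: "transpose P = P" using assms by (simp add: pos_def_def)
  have "transpose Q ** P = mat 1"
    by (metis Q(1) matrix_transpose_mul sym transpose_mat)
  then have "transpose Q = Q"
    by (metis Q(1) matrix_mul_assoc matrix_mul_lid matrix_mul_rid)
  moreover have "v \<bullet> (Q *v v) > 0" if "v \<noteq> 0" for v
  proof -
    have v: "P *v (Q *v v) = v" by (simp add: matrix_vector_mul_assoc Q)
    then have "Q *v v \<noteq> 0" using that by auto
    then have "(Q *v v) \<bullet> (P *v (Q *v v)) > 0" using assms by (simp add: pos_def_def)
    then show ?thesis by (simp add: v inner_commute)
  qed
  ultimately have "pos_def Q" by (simp add: pos_def_def)
  then show ?thesis using Q(1) that by blast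
qed

text \<open>Each pair of mutually transposed off-diagonal blocks contributes one doubled cross
  term.\<close>

lemma LMI_mat_quadratic_form:
  assumes "transpose P = P"
  shows "vjoin a (vjoin b (vjoin c (vjoin d e))) \<bullet>
      (LMI_mat P F Xp (r *\<^sub>R mat 1) \<epsilon> \<sigma> \<beta> *v vjoin a (vjoin b (vjoin c (vjoin d e)))) =
    a \<bullet> (P *v a) + \<sigma> * (b \<bullet> (P *v b)) + c \<bullet> (P *v c) - \<epsilon> * r\<^sup>2 * (c \<bullet> c) + d \<bullet> (P *v d) / \<beta>
    + \<epsilon> * (e \<bullet> e) + 2 * (c \<bullet> (Xp *v (F *v a))) + 2 * (c \<bullet> (P *v b)) + 2 * (d \<bullet> (P *v a))
    + 2 * (e \<bullet> (F *v a))"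
proof -
  have sym: "v \<bullet> (P *v w) = w \<bullet> (P *v v)" for v w
    by (metis assms inner_commute inner_transpose_mult)
  have 1: "a \<bullet> ((transpose F ** transpose Xp) *v c) = c \<bullet> (Xp *v (F *v a))"
    by (metis inner_commute inner_transpose_mult matrix_vector_mul_assoc)
  have 2: "a \<bullet> (transpose F *v e) = e \<bullet> (F *v a)"
    by (metis inner_commute inner_transpose_mult)
  have 3: "(r *\<^sub>R mat 1 ** transpose (r *\<^sub>R mat 1)) *v c = r\<^sup>2 *\<^sub>R c"
    by (simp add: transpose_scalar matrix_scalar_ac scalar_matrix_assoc[symmetric]
        scaleR_matrix_vector_assoc[symmetric] power2_eq_square)
  have 4: "(Xp ** F) *v a = Xp *v (F *v a)"
    by (simp add: matrix_vector_mul_assoc)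
  show ?thesis
    unfolding LMI_mat_def
    by (simp add: vcat_mult hcat_vjoin inner_vjoin inner_add_right matrix_vector_mult_diff_rdistrib
        scaleR_matrix_vector_assoc[symmetric] inner_diff_right 1 2 3 4
        sym[of a d] sym[of b c] divide_inverse algebra_simps del: transpose_matrix_vector)
qed

text \<open>With F = M P, evaluation at \<open>Q *v \<xi>\<close> removes P from F. The fourth entry
  of the test vector is the minimiser of the terms
  \<open>d \<bullet> (P *v d) / \<beta> + 2 * (d \<bullet> (P *v a))\<close>; the fifth is chosen so
  that its cross term cancels the one in \<open>W\<close>.\<close>

lemma dissipation_of_LMI:
  fixes P :: "real^'n^'n" and M :: "real^'n^'t"
  assumes sym: "transpose P = P" and inv: "P ** Q = mat 1"
    and psd: "\<And>v. v \<bullet> (LMI_mat P (M ** P) Xp (r *\<^sub>R mat 1) \<epsilon> \<sigma> \<beta> *v v) \<ge> 0"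
    and "\<epsilon> > 0" "\<beta> > 0"
    and W: "\<And>c. (norm (transpose W *v c))\<^sup>2 \<le> r\<^sup>2 * (norm c)\<^sup>2"
    and Xp: "Xp *v (M *v \<xi>) = y - w + W *v (M *v \<xi>)"
  shows "y \<bullet> (Q *v y) \<le> (1 - \<beta>) * (\<xi> \<bullet> (Q *v \<xi>)) + \<sigma> * (w \<bullet> (Q *v w))"
proof -
  have PQ: "P *v (Q *v v) = v" for v by (simp add: matrix_vector_mul_assoc inv)
  let ?c = "- (Q *v y)" and ?e = "transpose W *v (Q *v y)"
  have MP: "(M ** P) *v (Q *v \<xi>) = M *v \<xi>"
    by (simp add: matrix_vector_mul_assoc[symmetric] PQ)
  have neg: "A *v (- v) = - (A *v v)" for A :: "real^'n^'n" and v
    using matrix_vector_mult_scaleR[of A "-1" v] by simp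
  have e: "?e \<bullet> (M *v \<xi>) = (Q *v y) \<bullet> (W *v (M *v \<xi>))"
    by (metis inner_commute inner_transpose_mult)
  have "(norm ?e)\<^sup>2 \<le> r\<^sup>2 * (norm (Q *v y))\<^sup>2" by (rule W)
  then have W': "\<epsilon> * (?e \<bullet> ?e) \<le> \<epsilon> * r\<^sup>2 * ((Q *v y) \<bullet> (Q *v y))"
    using \<open>\<epsilon> > 0\<close> by (simp add: power2_norm_eq_inner mult.assoc)
  \<comment> \<open>Collecting terms: \<open>\<xi>\<close> gets the coefficient 1 + \<beta> -
    2\<beta> = 1 - \<beta>, \<open>y\<close> gets 1 - 2 = -1, the products of \<open>y\<close> and
    \<open>w\<close> cancel, and the two \<epsilon> terms have a nonpositive sum by
    \<open>W'\<close>.\<close>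
  have "0 \<le> (Q *v \<xi>) \<bullet> \<xi> + \<sigma> * ((Q *v w) \<bullet> w) + (Q *v y) \<bullet> y
      - \<epsilon> * r\<^sup>2 * ((Q *v y) \<bullet> (Q *v y)) + \<beta> * ((Q *v \<xi>) \<bullet> \<xi>) + \<epsilon> * (?e \<bullet> ?e)
      - 2 * ((Q *v y) \<bullet> (y - w + W *v (M *v \<xi>))) - 2 * ((Q *v y) \<bullet> w)
      - 2 * \<beta> * ((Q *v \<xi>) \<bullet> \<xi>) + 2 * ((Q *v y) \<bullet> (W *v (M *v \<xi>)))"
    using psd[of "vjoin (Q *v \<xi>) (vjoin (Q *v w) (vjoin ?c (vjoin (- \<beta> *\<^sub>R (Q *v \<xi>)) ?e)))"] \<open>\<beta> > 0\<close>
    unfolding LMI_mat_quadratic_form[OF sym] MP Xp e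
    by (simp add: PQ neg matrix_vector_mult_scaleR)
  with W' show ?thesis
    by (simp add: inner_commute inner_add_right inner_diff_right algebra_simps)
qed

subsection \<open>Exponential ISS from a quadratic dissipation inequality\<close>

text \<open>The constants are the minimum and maximum of the quadratic form on the compact unit
  sphere; homogeneity of degree two extends the bounds to all vectors.\<close>

lemma pos_def_bounds:
  fixes Q :: "real^'n^'n"
  assumes "pos_def Q"
  obtains m L where "m > 0" "L > 0" "\<And>v. m * (norm v)\<^sup>2 \<le> v \<bullet> (Q *v v)"
    "\<And>v. v \<bullet> (Q *v v) \<le> L * (norm v)\<^sup>2"
proof -
  let ?S = "sphere 0 1 :: (real^'n) set" and ?f = "\<lambda>v. v \<bullet> (Q *v v)"
  have cont: "continuous_on ?S ?f" by (intro continuous_intros)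
  have "axis undefined 1 \<in> ?S" by simp
  then have S: "compact ?S" "?S \<noteq> {}" by (auto simp only: compact_sphere)
  obtain v0 where v0: "v0 \<in> ?S" "\<And>v. v \<in> ?S \<Longrightarrow> ?f v0 \<le> ?f v"
    using continuous_attains_inf[OF S cont] by blast
  obtain v1 where v1: "v1 \<in> ?S" "\<And>v. v \<in> ?S \<Longrightarrow> ?f v \<le> ?f v1"
    using continuous_attains_sup[OF S cont] by blast
  have pos: "?f v > 0" if "v \<in> ?S" for v
  proof -
    have "v \<noteq> 0" using that by auto
    then show ?thesis using assms by (simp add: pos_def_def)
  qed
  have "?f v0 * (norm v)\<^sup>2 \<le> ?f v \<and> ?f v \<le> ?f v1 * (norm v)\<^sup>2" for v
  proof (cases "v = 0")
    case False
    let ?n = "inverse (norm v) *\<^sub>R v"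
    have n: "?n \<in> ?S" using False by simp
    have "?f v = ?f ?n * (norm v)\<^sup>2"
      using False by (simp add: matrix_vector_mult_scaleR power2_eq_square field_simps)
    then show ?thesis
      using v0(2)[OF n] v1(2)[OF n] by (simp only: mult_right_mono zero_le_power2 simp_thms)
  qed simp
  then show ?thesis using that[OF pos[OF v0(1)] pos[OF v1(1)]] by blast
qed

text \<open>The offset s / (1 - \<rho>) is the fixed point of t \<mapsto> \<rho> t + s, so the bound
  reproduces itself in the induction. The recurrence is assumed only below \<open>k\<close>, since
  \<open>s\<close> will be a supremum taken up to \<open>k\<close>.\<close>

lemma linear_recurrence_bound:
  fixes a :: "nat \<Rightarrow> real"
  assumes "\<And>i. i < k \<Longrightarrow> a (Suc i) \<le> \<rho> * a i + s" and "0 < \<rho>" "\<rho> < 1" "0 \<le> s"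
  shows "a k \<le> \<rho> ^ k * a 0 + s / (1 - \<rho>)"
  using assms(1)
proof (induction k)
  case (Suc k)
  have "a k \<le> \<rho> ^ k * a 0 + s / (1 - \<rho>)" using Suc by simp
  then have "\<rho> * a k \<le> \<rho> * (\<rho> ^ k * a 0 + s / (1 - \<rho>))" using \<open>0 < \<rho>\<close> by simp
  then have "a (Suc k) \<le> \<rho> * (\<rho> ^ k * a 0 + s / (1 - \<rho>)) + s" using Suc.prems[of k] by simp
  also have "\<dots> = \<rho> ^ Suc k * a 0 + s / (1 - \<rho>)"
    using \<open>\<rho> < 1\<close> by (simp add: field_simps)
  finally show ?case .
qed (use assms in auto)

lemma norm_le_sup_norm: "i < k \<Longrightarrow> norm (\<omega> i) \<le> sup_norm \<omega> k"
  unfolding sup_norm_def by (auto intro!: cSUP_upper)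

lemma sup_norm_nonneg: "sup_norm \<omega> k \<ge> 0"
proof (cases "k = 0")
  case False
  then show ?thesis using norm_le_sup_norm[of 0 k \<omega>] order_trans[OF norm_ge_zero] by blast
qed (simp add: sup_norm_def)

text \<open>The form of \<open>Q\<close> is an ISS Lyapunov function: it contracts by \<rho> per
  step up to a perturbation term and is equivalent to the squared norm. Taking square roots halves
  the decay rate -ln \<rho> and makes the gain linear.\<close>

lemma exp_ISS_of_quadratic_dissipation:
  fixes Q :: "real^'n^'n"
  assumes Q: "pos_def Q" and \<rho>: "0 < \<rho>" "\<rho> < 1" and "\<sigma> > 0"
    and diss: "\<And>q \<xi> w. q \<in> \<P> \<Longrightarrow> w \<in> \<Omega> \<Longrightarrow>
      f q \<xi> w \<bullet> (Q *v f q \<xi> w) \<le> \<rho> * (\<xi> \<bullet> (Q *v \<xi>)) + \<sigma> * (w \<bullet> (Q *v w))"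
  shows "exp_ISS \<P> \<Omega> f"
proof -
  obtain m L where m: "m > 0" "L > 0" "\<And>v. m * (norm v)\<^sup>2 \<le> v \<bullet> (Q *v v)"
    "\<And>v. v \<bullet> (Q *v v) \<le> L * (norm v)\<^sup>2"
    using pos_def_bounds[OF Q] by blast
  \<comment> \<open>Square root of the accumulated offset \<sigma> L / (1 - \<rho>), divided by the
    lower bound \<open>m\<close> of the form.\<close>
  define c where "c = sqrt (\<sigma> * L / (1 - \<rho>) / m)"
  have "c > 0" using m \<rho> \<open>\<sigma> > 0\<close> by (simp add: c_def)
  have bound: "norm (x k) \<le> sqrt (L / m) * exp (- (- ln \<rho> / 2) * real k) * norm (x 0)
      + c * sup_norm \<omega> k"
    if p: "\<forall>k. p k \<in> \<P>" and \<omega>: "\<forall>k. \<omega> k \<in> \<Omega>"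
      and x: "\<forall>k. x (Suc k) = f (p k) (x k) (\<omega> k)" for p x \<omega> and k :: nat
  proof -
    let ?V = "\<lambda>v. v \<bullet> (Q *v v)" and ?s = "sup_norm \<omega> k"
    let ?r = "exp (ln \<rho> / 2 * real k)"
    \<comment> \<open>The supremum at the fixed horizon \<open>k\<close> bounds every earlier
      perturbation, so one constant serves all steps.\<close>
    have "?V (x (Suc i)) \<le> \<rho> * ?V (x i) + \<sigma> * (L * ?s\<^sup>2)" if "i < k" for i
    proof -
      have "?V (\<omega> i) \<le> L * (norm (\<omega> i))\<^sup>2" by (rule m)
      also have "\<dots> \<le> L * ?s\<^sup>2"
        using norm_le_sup_norm[OF that, of \<omega>] m(2) by (simp add: power_mono)
      finally have "\<sigma> * ?V (\<omega> i) \<le> \<sigma> * (L * ?s\<^sup>2)" using \<open>\<sigma> > 0\<close> by simp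
      then show ?thesis using diss[of "p i" "\<omega> i" "x i"] p \<omega> x by fastforce
    qed
    then have "?V (x k) \<le> \<rho> ^ k * ?V (x 0) + \<sigma> * (L * ?s\<^sup>2) / (1 - \<rho>)"
      using \<rho> m(2) \<open>\<sigma> > 0\<close> by (intro linear_recurrence_bound[where a = "\<lambda>i. ?V (x i)"]) auto
    moreover have "\<rho> ^ k * ?V (x 0) \<le> \<rho> ^ k * (L * (norm (x 0))\<^sup>2)"
      using m(4) \<rho> by (intro mult_left_mono) auto
    ultimately have "m * (norm (x k))\<^sup>2 \<le> \<rho> ^ k * (L * (norm (x 0))\<^sup>2) + \<sigma> * (L * ?s\<^sup>2) / (1 - \<rho>)"
      using m(3)[of "x k"] by linarith
    then have "(norm (x k))\<^sup>2 \<le> (\<rho> ^ k * (L * (norm (x 0))\<^sup>2) + \<sigma> * (L * ?s\<^sup>2) / (1 - \<rho>)) / m"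
      using m(1) by (simp add: pos_le_divide_eq mult.commute)
    also have "\<dots> = L / m * \<rho> ^ k * (norm (x 0))\<^sup>2 + \<sigma> * L / (1 - \<rho>) / m * ?s\<^sup>2"
      by (simp add: add_divide_distrib mult_ac)
    also have "\<dots> = (sqrt (L / m) * ?r * norm (x 0))\<^sup>2 + (c * ?s)\<^sup>2"
    proof -
      have "?r\<^sup>2 = \<rho> ^ k"
        using \<rho> by (simp add: exp_of_nat_mult[symmetric] power2_eq_square exp_add[symmetric]
            mult.commute[of _ "real k"] exp_of_nat_mult)
      moreover have "c\<^sup>2 = \<sigma> * L / (1 - \<rho>) / m" "(sqrt (L / m))\<^sup>2 = L / m"
        using m \<rho> \<open>\<sigma> > 0\<close> by (simp_all add: c_def)
      ultimately show ?thesis by (simp only: power_mult_distrib)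
    qed
    \<comment> \<open>For nonnegative numbers a^2 + b^2 \<le> (a + b)^2, which separates the initial
      state from the perturbation once the root is taken.\<close>
    also have "\<dots> \<le> (sqrt (L / m) * ?r * norm (x 0) + c * ?s)\<^sup>2"
      using m \<open>c > 0\<close> sup_norm_nonneg[of \<omega> k] by (simp add: power2_sum)
    finally have "norm (x k) \<le> sqrt (L / m) * ?r * norm (x 0) + c * ?s"
      using m \<open>c > 0\<close> sup_norm_nonneg[of \<omega> k] by (elim power2_le_imp_le) simp
    then show ?thesis by simp
  qed
  have "class_K (\<lambda>t. c * t)"
    using \<open>c > 0\<close> unfolding class_K_def by (auto intro!: continuous_intros strict_mono_onI)
  moreover have "sqrt (L / m) > 0" "- ln \<rho> / 2 > 0" using m \<rho> by auto
  ultimately show ?thesis unfolding exp_ISS_def using bound by blast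
qed

theorem theorem1:
  fixes Ad0 :: "real^'n^'n" and Ad :: "'l::finite \<Rightarrow> real^'n^'n"
    and Bd0 :: "real^'m^'n" and Bd :: "'l \<Rightarrow> real^'m^'n"
    and \<P> :: "(real^'l) set" and \<delta> :: real
    and u :: "nat \<Rightarrow> real^'m" and p :: "nat \<Rightarrow> real^'l"
    and x :: "nat \<Rightarrow> real^'n" and \<omega> :: "nat \<Rightarrow> real^'n"
    and idx :: "'t::finite \<Rightarrow> nat"
    and U :: "real^'t^'m" and UP :: "real^'t^('l \<times> 'm)"
    and X :: "real^'t^'n" and XP :: "real^'t^('l \<times> 'n)"
    and Xplus :: "real^'t^'n"
    and G :: "real^'t^('n + 'l \<times> 'n + 'm + 'l \<times> 'm)"
    and \<Delta> :: "real^'n^'n"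
    and Kd0 :: "real^'n^'m" and Kd :: "'l \<Rightarrow> real^'n^'m"
    and V :: "real^('n + 'l \<times> 'n + 'l \<times> 'l \<times> 'n)^'t"
    and P :: "real^'n^'n" and \<epsilon>\<^sub>1 \<sigma> \<beta>\<^sub>1 :: real
  assumes delta_pos: "\<delta> > 0"
    and trajectory: "\<forall>k < CARD('t). x (Suc k) =
          affine_dep Ad0 Ad (p k) *v x k + affine_dep Bd0 Bd (p k) *v u k + \<omega> k"
    and scheduling: "\<forall>k \<le> CARD('t). p k \<in> \<P>"
    and perturbation: "\<forall>k \<le> CARD('t). norm (\<omega> k) \<le> \<delta>"
    and columns: "bij_betw idx UNIV {..<CARD('t)}"
    and U: "U = data_mat idx u"
    and UP: "UP = data_mat idx (\<lambda>k. p k \<otimes>\<^sub>v u k)"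
    and X: "X = data_mat idx x"
    and XP: "XP = data_mat idx (\<lambda>k. p k \<otimes>\<^sub>v x k)"
    and Xplus: "Xplus = data_mat idx (\<lambda>k. x (Suc k))"
    and G: "G = X /// XP /// U /// UP"
    and Delta: "\<Delta> = (sqrt (real CARD('t)) * \<delta>) *\<^sub>R mat 1"
    and gains: "N_cl Kd0 Kd = G ** V"
    and P: "pos_def P"
    and scalars: "\<epsilon>\<^sub>1 > 0" "\<sigma> > 1" "0 < \<beta>\<^sub>1" "\<beta>\<^sub>1 < 1"
    and LMI: "\<forall>q\<in>\<P>. pos_def (LMI_mat P (F_mat V P q) Xplus \<Delta> \<epsilon>\<^sub>1 \<sigma> \<beta>\<^sub>1)"
  shows "exp_ISS \<P> {w. norm w \<le> \<delta>}
           (\<lambda>q \<xi> w. (affine_dep Ad0 Ad q + affine_dep Bd0 Bd q ** affine_dep Kd0 Kd q) *v \<xi> + w)"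
proof -
  let ?A = "\<lambda>q. affine_dep Ad0 Ad q + affine_dep Bd0 Bd q ** affine_dep Kd0 Kd q"
  let ?M = "\<lambda>q. V ** (mat 1 /// q \<otimes>\<^sub>m mat 1 /// q \<otimes>\<^sub>m q \<otimes>\<^sub>m mat 1) :: real^'n^'t"
  let ?W = "data_mat idx \<omega>"
  let ?r = "sqrt (real CARD('t)) * \<delta>"
  have idx: "idx j < CARD('t)" for j
    using columns by (auto dest: bij_betwE)
  obtain Q where Q: "pos_def Q" "P ** Q = mat 1" using pos_def_inverse[OF P] .
  have "norm (\<omega> (idx j)) \<le> \<delta>" for j
    using perturbation idx[of j] by simp
  then have W: "(norm (transpose ?W *v c))\<^sup>2 \<le> ?r\<^sup>2 * (norm c)\<^sup>2" for c
    using norm_transpose_data_mat_mult_le[of \<omega> idx \<delta> c] by (simp add: power_mult_distrib)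
  \<comment> \<open>Adding and subtracting \<open>w\<close> gives the shape required by
    \<open>dissipation_of_LMI\<close> with y the successor state; the online perturbation
    \<open>w\<close> is independent of the recorded \<open>?W\<close>.\<close>
  have closed_loop: "Xplus *v (?M q *v \<xi>) = (?A q *v \<xi> + w) - w + ?W *v (?M q *v \<xi>)" for q \<xi> w
    using data_closed_loop[where ?A0.0 = Ad0 and A = Ad and ?B0.0 = Bd0 and B = Bd and x = x and p = p
        and u = u and \<omega> = \<omega> and idx = idx and ?K0.0 = Kd0 and K = Kd and V = V and q = q and \<xi> = \<xi>]
      trajectory idx gains
    by (simp add: G X XP U UP Xplus matrix_vector_mul_assoc)
  have "(?A q *v \<xi> + w) \<bullet> (Q *v (?A q *v \<xi> + w)) \<le>
      (1 - \<beta>\<^sub>1) * (\<xi> \<bullet> (Q *v \<xi>)) + \<sigma> * (w \<bullet> (Q *v w))" if "q \<in> \<P>" for q \<xi> w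
  proof (rule dissipation_of_LMI[OF _ Q(2) _ scalars(1,3) W closed_loop])
    show "transpose P = P" using P by (simp add: pos_def_def)
    have "pos_def (LMI_mat P (?M q ** P) Xplus (?r *\<^sub>R mat 1) \<epsilon>\<^sub>1 \<sigma> \<beta>\<^sub>1)"
      using LMI that unfolding F_mat_def Delta by blast
    then show "v \<bullet> (LMI_mat P (?M q ** P) Xplus (?r *\<^sub>R mat 1) \<epsilon>\<^sub>1 \<sigma> \<beta>\<^sub>1 *v v) \<ge> 0" for v
      by (cases "v = 0") (auto simp: pos_def_def intro: less_imp_le)
  qed
  \<comment> \<open>The contraction factor is 1 - \<open>\<beta>\<^sub>1\<close>, which lies
    strictly between 0 and 1.\<close>
  then show ?thesis
    using Q(1) scalars by (intro exp_ISS_of_quadratic_dissipation[where \<rho> = "1 - \<beta>\<^sub>1" and \<sigma> = \<sigma>]) auto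
qed

end
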